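(* Let $k\ge 1$ and consider the empirical $k$-th order TMLE $\Psi(P_n^{(1)}\cdots P_n^{(k)}(P_n^0))$, where for $j=1,\dots,k$, $P_n^{(j)}(P)=\tilde P_n^{(j)}(P,\epsilon_n^{(j)}(P))$ with $\epsilon_n^{(j)}(P)$ the solution in $\epsilon$ of $P_nD^{(j)}_{n,\tilde P_n^{(j)}(P,\epsilon)}=0$. It satisfies the exact expansion \[ \begin{aligned} \Psi(P_n^{(1)}\cdots P_n^{(k)}(P_n^0))-\Psi(P_0) &=\sum_{j=1}^{k}\Big\{(P_n-P_0)D^{(j)}_{n,P_n^{(j)}(P_0)}+R_n^{(j)}(P_n^{(j)}(P_0),P_0)\Big\}\\ &\quad+R_n^{(k)}(P_n^{(k)}(P_n^0),\tilde P_n)-R_n^{(k)}(P_n^{(k)}(P_0),\tilde P_n)\\ &\quad+\sum_{j=1}^k(\tilde P_n-P_n)\Big\{D^{(j)}_{n,P_n^{(j)}(P_0)}-D^{(j)}_{n,P_n^{(j)}P_n^{(j+1)}\cdots P_n^{(k)}(P_n^0)}\Big\}\\ &\quad+\sum_{j=1}^{k-1}\Big\{R_n^{(j)}(P_n^{(j)}\cdots P_n^{(k)}(P_n^0),\tilde P_n)-R_n^{(j)}(P_n^{(j)}(P_0),\tilde P_n)\Big\}\\ &\quad-\sum_{j=1}^{k-1}\Big\{R_n^{(j)}(\tilde P_n^{(j)}P_n^{(j+1)}\cdots P_n^{(k)}(P_n^0),\tilde P_n)-R_n^{(j)}(\tilde P_n^{(j)}(P_0),\tilde P_n)\Big\}.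 \end{aligned} \]
   Context: $O_1,\dots,O_n$ are i.i.d. from $P_0\in{\cal M}$, where the model ${\cal M}$ is a set of probability distributions dominated by a measure $\mu$ (densities $p=dP/d\mu$). $P_n$ is the empirical measure; $Pf=\int f\,dP$ for a (signed) measure $P$. A functional $\Phi:{\cal M}\to\mathbb R$ is pathwise differentiable at $P$ with canonical gradient $D_P$ if for every path $\{P_{\delta,h}\}\subset{\cal M}$ in a given class, through $P$ at $\delta=0$ with score $h$, $\frac{d}{d\delta}\Phi(P_{\delta,h})|_{\delta=0}=P D_Ph$, with $D_P$ in the tangent space $T_P({\cal M})\subset L^2_0(P)$ (closure of the linear span of the scores). In particular $PD_P=0$. $\Psi:{\cal M}\to\mathbb R$ is pathwise differentiable with canonical gradient $D^{(1)}_P$. $\tilde P_n\in{\cal M}$ is the HAL-MLE: a data-dependent maximum likelihood estimator of $P_0$ over the elements of ${\cal M}$ for which the cadlag function parametrizing the density has variation norm bounded by a constant; $d\tilde P_n/dP$ is assumed to exist at all $P$ used. Recursively, put $\Psi_n^{(0)}=\Psi$, $D^{(1)}_{n,P}=D^{(1)}_P$. For $j\ge1$: $D^{(j)}_{n,P}$ is the canonical gradient of $\Psi_n^{(j-1)}$ at $P$; $\{\tilde P_n^{(j)}(P,\epsilon):\epsilon\}\subset{\cal M}$ is a least favorable path through $P$ at $\epsilon=0$ whose score at $\epsilon=0$ spans $D^{(j)}_{n,P}$; $\tilde\epsilon_n^{(j)}(P)$ is the solution in $\epsilon$ of $\tilde P_nD^{(j)}_{n,\tilde P_n^{(j)}(P,\epsilon)}=0$;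 $\tilde P_n^{(j)}(P)=\tilde P_n^{(j)}(P,\tilde\epsilon_n^{(j)}(P))$ is the HAL-regularized TMLE update (so $\tilde P_nD^{(j)}_{n,\tilde P_n^{(j)}(P)}=0$); and $\Psi_n^{(j)}(P)=\Psi_n^{(j-1)}(\tilde P_n^{(j)}(P))$ (always defined with the HAL-regularized updates). The HAL-MLE is a fixed point: $\tilde P_n^{(j)}(\tilde P_n)=\tilde P_n$. The exact remainder is $R_n^{(j)}(P,P')=\Psi_n^{(j-1)}(P)-\Psi_n^{(j-1)}(P')+P'D^{(j)}_{n,P}$. All these objects are assumed to exist at the distributions where they are used. Juxtaposition of update maps denotes composition. $P_n^0\in{\cal M}$ is an initial estimator. *)

theory Defs
  imports "HOL-Probability.Probability"
begin

section \<open>Dominated models, scores, and canonical gradients\<close>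

text \<open>Domination is expressed by the existence of a density, so that no sigma-finiteness
  of the dominating measure has to be added.\<close>

definition dominated_model :: "'o measure \<Rightarrow> 'o measure set \<Rightarrow> bool" where
  "dominated_model \<mu> M \<longleftrightarrow>
     (\<forall>P\<in>M. prob_space P \<and> (\<exists>p\<in>borel_measurable \<mu>. P = density \<mu> p))"

definition L2_0 :: "'o measure \<Rightarrow> ('o \<Rightarrow> real) set" where
  "L2_0 P = {f \<in> borel_measurable P. integrable P (\<lambda>x. (f x)\<^sup>2) \<and> (\<integral>x. f x \<partial>P) = 0}"

definition dens :: "'o measure \<Rightarrow> 'o measure \<Rightarrow> 'o \<Rightarrow> real" where
  "dens \<mu> P x = enn2real (RN_deriv \<mu> P x)"

text \<open>The score of a path at parameter value 0 is its log-density derivative in the sense of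
  differentiability in quadratic mean.  This notion does not depend on the versions chosen for the
  uncountably many densities along the path.\<close>

definition has_score :: "'o measure \<Rightarrow> (real \<Rightarrow> 'o measure) \<Rightarrow> ('o \<Rightarrow> real) \<Rightarrow> bool" where
  "has_score \<mu> \<gamma> h \<longleftrightarrow> h \<in> L2_0 (\<gamma> 0) \<and>
     ((\<lambda>\<delta>. \<integral>\<^sup>+x. ennreal (((sqrt (dens \<mu> (\<gamma> \<delta>) x) - sqrt (dens \<mu> (\<gamma> 0) x)) / \<delta>
                        - h x * sqrt (dens \<mu> (\<gamma> 0) x) / 2)\<^sup>2) \<partial>\<mu>) \<longlongrightarrow> 0) (at 0)"

text \<open>The set \<open>\<C>\<close> is the given class of paths; only its members that stay in the model near 0 and
  have a score take part.\<close>

definition path_through ::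
  "'o measure \<Rightarrow> 'o measure set \<Rightarrow> (real \<Rightarrow> 'o measure) set \<Rightarrow> 'o measure
    \<Rightarrow> (real \<Rightarrow> 'o measure) \<Rightarrow> ('o \<Rightarrow> real) \<Rightarrow> bool" where
  "path_through \<mu> M \<C> P \<gamma> h \<longleftrightarrow>
     \<gamma> \<in> \<C> \<and> \<gamma> 0 = P \<and> (\<forall>\<^sub>F \<delta> in at 0. \<gamma> \<delta> \<in> M) \<and> has_score \<mu> \<gamma> h"

definition scores ::
  "'o measure \<Rightarrow> 'o measure set \<Rightarrow> (real \<Rightarrow> 'o measure) set \<Rightarrow> 'o measure \<Rightarrow> ('o \<Rightarrow> real) set" where
  "scores \<mu> M \<C> P = {h. \<exists>\<gamma>. path_through \<mu> M \<C> P \<gamma> h}"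

text \<open>Closure in \<open>L\<^sup>2(P)\<close> of the linear span of the scores.\<close>

definition tangent_space ::
  "'o measure \<Rightarrow> 'o measure set \<Rightarrow> (real \<Rightarrow> 'o measure) set \<Rightarrow> 'o measure \<Rightarrow> ('o \<Rightarrow> real) set" where
  "tangent_space \<mu> M \<C> P = {f \<in> L2_0 P. \<forall>e>0. \<exists>H c. finite H \<and> H \<subseteq> scores \<mu> M \<C> P \<and>
     (\<integral>x. (f x - (\<Sum>h\<in>H. c h * h x))\<^sup>2 \<partial>P) < e}"

text \<open>The functional \<open>\<Phi>\<close> may be defined on a subset \<open>A\<close> of the model only; then the derivative
  along a path makes sense only if the path stays in \<open>A\<close> near 0.\<close>

definition canonical_gradient ::
  "'o measure \<Rightarrow> 'o measure set \<Rightarrow> (real \<Rightarrow> 'o measure) set \<Rightarrow> 'o measure set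
    \<Rightarrow> ('o measure \<Rightarrow> real) \<Rightarrow> 'o measure \<Rightarrow> ('o \<Rightarrow> real) \<Rightarrow> bool" where
  "canonical_gradient \<mu> M \<C> A \<Phi> P D \<longleftrightarrow>
     P \<in> A \<and> D \<in> tangent_space \<mu> M \<C> P \<and>
     (\<forall>\<gamma> h. path_through \<mu> M \<C> P \<gamma> h \<longrightarrow>
        (\<forall>\<^sub>F \<delta> in at 0. \<gamma> \<delta> \<in> A) \<and>
        ((\<lambda>\<delta>. \<Phi> (\<gamma> \<delta>)) has_real_derivative (\<integral>x. D x * h x \<partial>P)) (at 0))"

text \<open>A one-dimensional least favorable path, with parameter set \<open>E\<close>: the linear span of its score
  contains \<open>D\<close>.\<close>

definition least_favorable_path ::
  "'o measure \<Rightarrow> 'o measure set \<Rightarrow> 'o measure \<Rightarrow> real set \<Rightarrow> (real \<Rightarrow> 'o measure)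
    \<Rightarrow> ('o \<Rightarrow> real) \<Rightarrow> bool" where
  "least_favorable_path \<mu> A P E \<gamma> D \<longleftrightarrow>
     0 \<in> interior E \<and> \<gamma> 0 = P \<and> \<gamma> ` E \<subseteq> A \<and>
     (\<exists>h c. has_score \<mu> \<gamma> h \<and> (AE x in P. D x = c * h x))"

section \<open>Empirical measure and HAL-MLE\<close>

definition empirical :: "'o measure \<Rightarrow> nat \<Rightarrow> (nat \<Rightarrow> 'o) \<Rightarrow> 'o measure" where
  "empirical \<mu> n x = distr (uniform_count_measure {1..n}) \<mu> x"

text \<open>Integral with respect to the signed measure \<open>P - Q\<close>.\<close>

definition diff_integral :: "'o measure \<Rightarrow> 'o measure \<Rightarrow> ('o \<Rightarrow> real) \<Rightarrow> real" where
  "diff_integral P Q f = (\<integral>x. f x \<partial>P) - (\<integral>x. f x \<partial>Q)"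

text \<open>Multivariate cadlag functions on the cube \<open>[0, \<tau>]\<close>: a limit exists from every quadrant, and
  the function is continuous from the closed upper quadrant.\<close>

definition cadlag :: "real ^ 'd \<Rightarrow> (real ^ 'd \<Rightarrow> real) \<Rightarrow> bool" where
  "cadlag \<tau> f \<longleftrightarrow> (\<forall>x \<in> {x. \<forall>i. 0 \<le> x $ i \<and> x $ i \<le> \<tau> $ i}.
     (\<forall>S. \<exists>l. (f \<longlongrightarrow> l) (at x within
        {y. \<forall>i. 0 \<le> y $ i \<and> y $ i \<le> \<tau> $ i \<and> (if i \<in> S then y $ i < x $ i else x $ i \<le> y $ i)})) \<and>
     (f \<longlongrightarrow> f x) (at x within {y. \<forall>i. x $ i \<le> y $ i \<and> y $ i \<le> \<tau> $ i}))"

text \<open>Generalized increment over the box \<open>(a, b]\<close> of the \<open>s\<close>-section of \<open>f\<close>, in which the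
  coordinates outside \<open>s\<close> are set to 0.\<close>

definition section_increment ::
  "'d::finite set \<Rightarrow> (real ^ 'd \<Rightarrow> real) \<Rightarrow> real ^ 'd \<Rightarrow> real ^ 'd \<Rightarrow> real" where
  "section_increment s f a b =
     (\<Sum>t\<in>Pow s. (- 1) ^ card t * f (\<chi> i. if i \<in> t then a $ i else if i \<in> s then b $ i else 0))"

definition box_families ::
  "real ^ 'd \<Rightarrow> 'd::finite set \<Rightarrow> ((real ^ 'd) \<times> (real ^ 'd)) set set" where
  "box_families \<tau> s = {B. finite B \<and>
     (\<forall>(a, b)\<in>B. \<forall>i\<in>s. 0 \<le> a $ i \<and> a $ i < b $ i \<and> b $ i \<le> \<tau> $ i) \<and>
     disjoint_family_on (\<lambda>(a, b). {u. \<forall>i\<in>s. a $ i < u $ i \<and> u $ i \<le> b $ i}) B}"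

text \<open>Sectional variation norm
  \<open>|f(0)| + \<Sum>\<^sub>s \<integral> |df\<^sub>s|\<close>, the sum ranging over the nonempty sets \<open>s\<close> of coordinates and the integral
  over \<open>(0\<^sub>s, \<tau>\<^sub>s]\<close>; the total variation of a section is a supremum over finite disjoint
  families of boxes.\<close>

definition variation_norm :: "real ^ 'd \<Rightarrow> (real ^ 'd \<Rightarrow> real) \<Rightarrow> ennreal" where
  "variation_norm \<tau> f = ennreal \<bar>f 0\<bar> +
     (\<Sum>s | s \<noteq> {}. SUP B\<in>box_families \<tau> s. \<Sum>(a, b)\<in>B. ennreal \<bar>section_increment s f a b\<bar>)"

text \<open>The map \<open>dn\<close> sends a parametrizing function to the density it parametrizes.\<close>

definition hal_class ::
  "'o measure \<Rightarrow> 'o measure set \<Rightarrow> ((real ^ 'd \<Rightarrow> real) \<Rightarrow> 'o \<Rightarrow> real) \<Rightarrow> real ^ 'd \<Rightarrow> real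
    \<Rightarrow> (real ^ 'd \<Rightarrow> real) set" where
  "hal_class \<mu> M dn \<tau> C = {f. cadlag \<tau> f \<and> variation_norm \<tau> f \<le> ennreal C \<and>
     dn f \<in> borel_measurable \<mu> \<and> (\<forall>x\<in>space \<mu>. 0 \<le> dn f x) \<and>
     density \<mu> (\<lambda>x. ennreal (dn f x)) \<in> M}"

text \<open>The likelihood is maximized instead of the log-likelihood because \<open>ln 0 = 0\<close>.\<close>

definition is_hal_mle ::
  "'o measure \<Rightarrow> 'o measure set \<Rightarrow> ((real ^ 'd \<Rightarrow> real) \<Rightarrow> 'o \<Rightarrow> real) \<Rightarrow> real ^ 'd \<Rightarrow> real
    \<Rightarrow> nat \<Rightarrow> (nat \<Rightarrow> 'o) \<Rightarrow> 'o measure \<Rightarrow> bool" where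
  "is_hal_mle \<mu> M dn \<tau> C n x P \<longleftrightarrow>
     (\<exists>f\<in>hal_class \<mu> M dn \<tau> C. P = density \<mu> (\<lambda>y. ennreal (dn f y)) \<and>
        (\<forall>g\<in>hal_class \<mu> M dn \<tau> C. (\<Prod>i=1..n. dn g (x i)) \<le> (\<Prod>i=1..n. dn f (x i))))"

section \<open>Higher-order TMLE\<close>

text \<open>The data-dependent ingredients, for one realization of the sample:
  \<open>hal\<close> is the HAL-MLE, \<open>init\<close> the initial estimator, \<open>grad T j P\<close> the \<open>j\<close>-th order canonical gradient
  at \<open>P\<close>, \<open>lfp T j P\<close> the \<open>j\<close>-th order least favorable path through \<open>P\<close>, with parameter set
  \<open>lfp_range T j P\<close>; \<open>eps_hal\<close> and \<open>eps_emp\<close> are the solutions of the score equation under the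
  HAL-MLE and under the empirical measure.  Orders start at 1.\<close>

record 'o tmle =
  hal :: "'o measure"
  init :: "'o measure"
  grad :: "nat \<Rightarrow> 'o measure \<Rightarrow> 'o \<Rightarrow> real"
  lfp :: "nat \<Rightarrow> 'o measure \<Rightarrow> real \<Rightarrow> 'o measure"
  lfp_range :: "nat \<Rightarrow> 'o measure \<Rightarrow> real set"
  eps_hal :: "nat \<Rightarrow> 'o measure \<Rightarrow> real"
  eps_emp :: "nat \<Rightarrow> 'o measure \<Rightarrow> real"

definition solves_score_eq ::
  "'o tmle \<Rightarrow> 'o measure \<Rightarrow> nat \<Rightarrow> 'o measure \<Rightarrow> real \<Rightarrow> bool" where
  "solves_score_eq T N j P e \<longleftrightarrow>
     e \<in> lfp_range T j P \<and> (\<integral>x. grad T j (lfp T j P e) x \<partial>N) = 0"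

definition upd_hal :: "'o tmle \<Rightarrow> nat \<Rightarrow> 'o measure \<Rightarrow> 'o measure" where
  "upd_hal T j P = lfp T j P (eps_hal T j P)"

definition upd_emp :: "'o tmle \<Rightarrow> nat \<Rightarrow> 'o measure \<Rightarrow> 'o measure" where
  "upd_emp T j P = lfp T j P (eps_emp T j P)"

primrec target :: "('o measure \<Rightarrow> real) \<Rightarrow> 'o tmle \<Rightarrow> nat \<Rightarrow> 'o measure \<Rightarrow> real" where
  "target \<Psi> T 0 = \<Psi>"
| "target \<Psi> T (Suc j) = (\<lambda>P. target \<Psi> T j (upd_hal T (Suc j) P))"

definition remainder ::
  "('o measure \<Rightarrow> real) \<Rightarrow> 'o tmle \<Rightarrow> nat \<Rightarrow> 'o measure \<Rightarrow> 'o measure \<Rightarrow> real" where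
  "remainder \<Psi> T j P P' =
     target \<Psi> T (j - 1) P - target \<Psi> T (j - 1) P' + (\<integral>x. grad T j P x \<partial>P')"

text \<open>\<open>tmle_dom \<mu> M \<C> \<Psi> T j\<close> is the set of distributions at which the constructions up to order
  \<open>j\<close> exist, in particular the functional \<open>target \<Psi> T j\<close>.  It decreases in \<open>j\<close>, because the
  least favorable path through \<open>P\<close> contains \<open>P\<close>.\<close>

primrec tmle_dom ::
  "'o measure \<Rightarrow> 'o measure set \<Rightarrow> (real \<Rightarrow> 'o measure) set \<Rightarrow> ('o measure \<Rightarrow> real) \<Rightarrow> 'o tmle
    \<Rightarrow> nat \<Rightarrow> 'o measure set" where
  "tmle_dom \<mu> M \<C> \<Psi> T 0 = M"
| "tmle_dom \<mu> M \<C> \<Psi> T (Suc j) = {P.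
     least_favorable_path \<mu> (tmle_dom \<mu> M \<C> \<Psi> T j) P
       (lfp_range T (Suc j) P) (lfp T (Suc j) P) (grad T (Suc j) P) \<and>
     (\<forall>P' \<in> lfp T (Suc j) P ` lfp_range T (Suc j) P.
        canonical_gradient \<mu> M \<C> (tmle_dom \<mu> M \<C> \<Psi> T j) (target \<Psi> T j) P' (grad T (Suc j) P') \<and>
        absolutely_continuous P' (hal T) \<and>
        integrable (hal T) (grad T (Suc j) P')) \<and>
     solves_score_eq T (hal T) (Suc j) P (eps_hal T (Suc j) P)}"

text \<open>\<open>iter_emp T j k P\<close> applies the empirical updates of orders \<open>k, k - 1, \<dots>, j\<close>, in this order,
  to \<open>P\<close>; it is \<open>P\<close> itself for \<open>j = k + 1\<close>.\<close>

definition iter_emp :: "'o tmle \<Rightarrow> nat \<Rightarrow> nat \<Rightarrow> 'o measure \<Rightarrow> 'o measure" where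
  "iter_emp T j k P = foldr (upd_emp T) [j..<Suc k] P"

end

theory Submission imports Defs
begin

text \<open>The expansion is a telescoping sum.  Let \<open>\<Psi>\<^sub>j\<close> be the functional of order \<open>j\<close>, let
  \<open>H\<close> be the HAL-MLE, let \<open>U\<^sub>j\<close> be the empirical update of order \<open>j\<close> of \<open>P\<^sub>0\<close>, and let
  \<open>Q\<^sub>j\<close> be the initial estimator after the empirical updates of orders \<open>k, \<dots>, j\<close>, so that
  \<open>Q\<^sub>k\<^sub>+\<^sub>1\<close> is the initial estimator itself.  The estimation error is
  \<open>\<Psi>\<^sub>0(Q\<^sub>1) - \<Psi>\<^sub>0(P\<^sub>0)\<close>.

  In the terms of order \<open>j\<close> coming from the empirical updates, all integrals disappear: the
  \<open>P\<^sub>0\<close>-integral in the first remainder cancels against the one in \<open>P\<^sub>n - P\<^sub>0\<close>, the \<open>H\<close>-integrals in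
  the remainders at \<open>H\<close> cancel against those in \<open>H - P\<^sub>n\<close>, and the \<open>P\<^sub>n\<close>-integrals vanish because
  \<open>U\<^sub>j\<close> and \<open>Q\<^sub>j\<close> solve the empirical score equation.  What is left is \<open>\<Psi>\<^sub>j\<^sub>-\<^sub>1(Q\<^sub>j) - \<Psi>\<^sub>j\<^sub>-\<^sub>1(P\<^sub>0)\<close>
  (lemma \<open>empirical_terms_collapse\<close>).  The HAL-updates solve the score equation of \<open>H\<close>, and
  \<open>\<Psi>\<^sub>j\<close> is by definition \<open>\<Psi>\<^sub>j\<^sub>-\<^sub>1\<close> after the HAL-update of order \<open>j\<close>, so the terms coming from them
  are \<open>\<Psi>\<^sub>j(Q\<^sub>j\<^sub>+\<^sub>1) - \<Psi>\<^sub>j(P\<^sub>0)\<close> (lemma \<open>hal_terms_collapse\<close>): exactly the previous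
  terms with the order raised by one.  Subtracting the latter for \<open>j < k\<close> from the former for
  \<open>j \<le> k\<close> leaves the former for \<open>j = 1\<close>.

  Splitting the integral of a difference of gradients needs integrability under \<open>H\<close> and under the
  empirical measure, and the score equation of \<open>H\<close> is needed at every \<open>Q\<^sub>j\<^sub>+\<^sub>1\<close>.  The
  empirical measure has finite support, so measurability suffices there; the rest is a matter of
  domain: each empirical update moves along a least favorable path, which costs one order of the
  existence domain, and the recursion from order \<open>k\<close> down to order \<open>j + 1\<close> therefore still ends in the
  domain of order \<open>j\<close> (lemma \<open>iter_emp_in_tmle_dom\<close>).\<close>

section \<open>Existence domains\<close>

text \<open>A path passes through its starting point at parameter value 0, which belongs to the parameter
  set; so a distribution whose path lies in a domain lies itself in it.\<close>

lemma tmle_dom_Suc_subset: "tmle_dom \<mu> M \<C> \<Psi> T (Suc j) \<subseteq> tmle_dom \<mu> M \<C> \<Psi> T j"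
proof
  fix P assume "P \<in> tmle_dom \<mu> M \<C> \<Psi> T (Suc j)"
  then have path: "least_favorable_path \<mu> (tmle_dom \<mu> M \<C> \<Psi> T j) P
      (lfp_range T (Suc j) P) (lfp T (Suc j) P) (grad T (Suc j) P)"
    by simp
  then have "0 \<in> lfp_range T (Suc j) P"
    unfolding least_favorable_path_def using interior_subset by blast
  with path show "P \<in> tmle_dom \<mu> M \<C> \<Psi> T j"
    unfolding least_favorable_path_def by (metis image_subset_iff)
qed

lemma tmle_dom_antimono:
  assumes "i \<le> j"
  shows "tmle_dom \<mu> M \<C> \<Psi> T j \<subseteq> tmle_dom \<mu> M \<C> \<Psi> T i"
  using lift_Suc_antimono_le[of "tmle_dom \<mu> M \<C> \<Psi> T", OF tmle_dom_Suc_subset assms] .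

lemma tmle_dom_subset_model: "tmle_dom \<mu> M \<C> \<Psi> T j \<subseteq> M"
  using tmle_dom_antimono[of 0 j \<mu> M \<C> \<Psi> T] by simp

context
  fixes \<mu> :: "'o measure" and M :: "'o measure set" and \<C> :: "(real \<Rightarrow> 'o measure) set"
    and \<Psi> :: "'o measure \<Rightarrow> real" and T :: "'o tmle" and j :: nat and P :: "'o measure" and e :: real
  assumes dom: "P \<in> tmle_dom \<mu> M \<C> \<Psi> T (Suc j)"
    and e: "e \<in> lfp_range T (Suc j) P"
begin

lemma lfp_in_tmle_dom: "lfp T (Suc j) P e \<in> tmle_dom \<mu> M \<C> \<Psi> T j"
  using dom e unfolding tmle_dom.simps least_favorable_path_def by blast

lemma integrable_hal_grad: "integrable (hal T) (grad T (Suc j) (lfp T (Suc j) P e))"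
  using dom e by simp

text \<open>Gradients lie in \<open>L\<^sup>2\<close> of their distribution, hence are measurable for the
  \<open>\<sigma>\<close>-algebra of the dominating measure, which all elements of the model share.\<close>

lemma grad_measurable:
  assumes "dominated_model \<mu> M"
  shows "grad T (Suc j) (lfp T (Suc j) P e) \<in> borel_measurable \<mu>"
proof -
  let ?P' = "lfp T (Suc j) P e"
  have "canonical_gradient \<mu> M \<C> (tmle_dom \<mu> M \<C> \<Psi> T j) (target \<Psi> T j) ?P' (grad T (Suc j) ?P')"
    using dom e by simp
  then have meas: "grad T (Suc j) ?P' \<in> borel_measurable ?P'"
    unfolding canonical_gradient_def tangent_space_def L2_0_def by blast
  have "?P' \<in> M"
    using lfp_in_tmle_dom tmle_dom_subset_model by blast
  then have "sets ?P' = sets \<mu>"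
    using assms unfolding dominated_model_def by (metis sets_density)
  with meas show ?thesis
    using measurable_cong_sets by blast
qed

end

lemma iter_emp_step:
  "j \<le> k \<Longrightarrow> iter_emp T j k P = upd_emp T j (iter_emp T (Suc j) k P)"
  by (simp add: iter_emp_def upt_conv_Cons del: upt_Suc)

text \<open>Each empirical update lowers the order of the domain by one, starting from order \<open>k\<close> at \<open>P\<close>.
  The order of the update that is applied next is thus always available.\<close>

lemma iter_emp_in_tmle_dom:
  assumes "P \<in> tmle_dom \<mu> M \<C> \<Psi> T k"
    and range: "\<And>i. i \<in> {1..k} \<Longrightarrow>
      eps_emp T i (iter_emp T (Suc i) k P) \<in> lfp_range T i (iter_emp T (Suc i) k P)"
    and "j \<le> k"
  shows "iter_emp T (Suc j) k P \<in> tmle_dom \<mu> M \<C> \<Psi> T j"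
  using \<open>j \<le> k\<close>
proof (induction rule: inc_induct)
  case base
  then show ?case using assms(1) by (simp add: iter_emp_def)
next
  case (step i)
  then show ?case
    using lfp_in_tmle_dom[OF step.IH range[of "Suc i"]] iter_emp_step[of "Suc i" k T P]
    by (simp add: upd_emp_def)
qed

section \<open>Empirical measure\<close>

lemma integrable_empirical:
  fixes f :: "'o \<Rightarrow> real"
  assumes "f \<in> borel_measurable \<mu>" "x \<in> {1..n} \<rightarrow> space \<mu>"
  shows "integrable (empirical \<mu> n x) f"
proof -
  have "x \<in> measurable (uniform_count_measure {1..n}) \<mu>"
    using assms(2) by (auto simp: measurable_def space_uniform_count_measure sets_uniform_count_measure)
  moreover have "integrable (uniform_count_measure {1..n}) (\<lambda>i. f (x i))"
    unfolding uniform_count_measure_def 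
    by (rule integrable_point_measure_finite[where f = "\<lambda>_. 1 / real (card {1..n})"]) simp
  ultimately show ?thesis
    unfolding empirical_def using assms(1) by (simp add: integrable_distr_eq)
qed

section \<open>Collapse of the terms of one order\<close>

text \<open>Here \<open>U\<close> and \<open>Q\<close> are the empirical updates of order \<open>j\<close> of \<open>P\<^sub>0\<close> and of another
  distribution; the \<open>P\<^sub>0\<close>- and HAL-integrals cancel in pairs, and the
  score equations remove the empirical ones.\<close>

lemma empirical_terms_collapse:
  assumes score: "(\<integral>x. grad T j U x \<partial>Pn) = 0" "(\<integral>x. grad T j Q x \<partial>Pn) = 0"
    and int_n: "integrable Pn (grad T j U)" "integrable Pn (grad T j Q)"
    and int_hal: "integrable (hal T) (grad T j U)" "integrable (hal T) (grad T j Q)"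
  shows "diff_integral Pn P0 (grad T j U) + remainder \<Psi> T j U P0
      + diff_integral (hal T) Pn (\<lambda>y. grad T j U y - grad T j Q y)
      + (remainder \<Psi> T j Q (hal T) - remainder \<Psi> T j U (hal T))
    = target \<Psi> T (j - 1) Q - target \<Psi> T (j - 1) P0"
  using assms by (simp add: diff_integral_def remainder_def)

text \<open>The score equations remove the integrals, and the difference eliminates the value of the
  functional at the HAL-MLE; evaluating the functional of order \<open>j\<close> after the HAL-update is what defines
  the functional of order \<open>j + 1\<close>.\<close>

lemma hal_terms_collapse:
  assumes "solves_score_eq T (hal T) (Suc j) P (eps_hal T (Suc j) P)"
    and "solves_score_eq T (hal T) (Suc j) P' (eps_hal T (Suc j) P')"
  shows "remainder \<Psi> T (Suc j) (upd_hal T (Suc j) P) (hal T)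
      - remainder \<Psi> T (Suc j) (upd_hal T (Suc j) P') (hal T)
    = target \<Psi> T (Suc j) P - target \<Psi> T (Suc j) P'"
  using assms by (simp add: solves_score_eq_def remainder_def upd_hal_def)

section \<open>The expansion\<close>

theorem theorem3:
  fixes \<mu> :: "'o measure"
    and M :: "'o measure set"
    and \<C> :: "(real \<Rightarrow> 'o measure) set"
    and \<Psi> :: "'o measure \<Rightarrow> real"
    and D1 :: "'o measure \<Rightarrow> 'o \<Rightarrow> real"
    and P0 Pn :: "'o measure"
    and W :: "'w measure"
    and X :: "nat \<Rightarrow> 'w \<Rightarrow> 'o"
    and x :: "nat \<Rightarrow> 'o"
    and dn :: "(real ^ 'd \<Rightarrow> real) \<Rightarrow> 'o \<Rightarrow> real"
    and \<tau> :: "real ^ 'd"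
    and C :: real
    and est :: "(nat \<Rightarrow> 'o) \<Rightarrow> 'o tmle"
    and T :: "'o tmle"
    and n k :: nat
  assumes model: "dominated_model \<mu> M" "P0 \<in> M"
    and iid: "prob_space W" "n \<ge> 1" "prob_space.indep_vars W (\<lambda>_. \<mu>) X {1..n}"
      "\<And>i. i \<in> {1..n} \<Longrightarrow> distr W \<mu> (X i) = P0"
    and sample: "\<omega> \<in> space W" "x = (\<lambda>i\<in>{1..n}. X i \<omega>)"
    and empirical: "Pn = empirical \<mu> n x"
    and estimators: "T = est x"
    and hal_mle: "\<And>i. \<tau> $ i > 0" "is_hal_mle \<mu> M dn \<tau> C n x (hal T)"
    and initial: "init T \<in> M"
    and gradient: "\<And>P. P \<in> M \<Longrightarrow> canonical_gradient \<mu> M \<C> M \<Psi> P (D1 P)"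
      "\<And>P. P \<in> M \<Longrightarrow> grad T 1 P = D1 P"
    and k: "k \<ge> 1"
    and exist_hal: "{P0, hal T, init T} \<subseteq> tmle_dom \<mu> M \<C> \<Psi> T k"
    and exist_emp: "\<And>j P. j \<in> {1..k} \<Longrightarrow> P \<in> {P0, iter_emp T (j + 1) k (init T)} \<Longrightarrow>
      solves_score_eq T Pn j P (eps_emp T j P)"
    and exist_P0: "\<And>j. j \<in> {1..k} \<Longrightarrow> integrable P0 (grad T j (upd_emp T j P0))"
    and fixed_point: "\<And>j. j \<in> {1..k} \<Longrightarrow> upd_hal T j (hal T) = hal T"
  shows "\<Psi> (iter_emp T 1 k (init T)) - \<Psi> P0
    = (\<Sum>j=1..k. diff_integral Pn P0 (grad T j (upd_emp T j P0))
                 + remainder \<Psi> T j (upd_emp T j P0) P0)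
      + remainder \<Psi> T k (upd_emp T k (init T)) (hal T)
      - remainder \<Psi> T k (upd_emp T k P0) (hal T)
      + (\<Sum>j=1..k. diff_integral (hal T) Pn
           (\<lambda>y. grad T j (upd_emp T j P0) y - grad T j (iter_emp T j k (init T)) y))
      + (\<Sum>j=1..k-1. remainder \<Psi> T j (iter_emp T j k (init T)) (hal T)
                     - remainder \<Psi> T j (upd_emp T j P0) (hal T))
      - (\<Sum>j=1..k-1. remainder \<Psi> T j (upd_hal T j (iter_emp T (j + 1) k (init T))) (hal T)
                     - remainder \<Psi> T j (upd_hal T j P0) (hal T))"
proof -
  let ?H = "hal T"
  define Q where "Q j = iter_emp T j k (init T)" for j
  define U where "U j = upd_emp T j P0" for j
  have sample_in_space: "x \<in> {1..n} \<rightarrow> space \<mu>"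
  proof
    fix i assume i: "i \<in> {1..n}"
    then have "X i \<in> measurable W \<mu>"
      using iid(3) unfolding prob_space.indep_vars_def[OF iid(1)] by simp
    then have "X i \<omega> \<in> space \<mu>"
      using sample(1) by (rule measurable_space)
    then show "x i \<in> space \<mu>"
      using i by (simp add: sample(2))
  qed
  have Q_step: "Q j = upd_emp T j (Q (Suc j))" if "j \<le> k" for j
    unfolding Q_def by (rule iter_emp_step[OF that])
  have score_P0: "solves_score_eq T Pn j P0 (eps_emp T j P0)"
    and score_Q: "solves_score_eq T Pn j (Q (Suc j)) (eps_emp T j (Q (Suc j)))"
    if "j \<in> {1..k}" for j
    using exist_emp[OF that, of P0] exist_emp[OF that, of "Q (Suc j)"] by (simp_all add: Q_def)
  have dom_P0: "P0 \<in> tmle_dom \<mu> M \<C> \<Psi> T j" if "j \<le> k" for j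
    using exist_hal tmle_dom_antimono[OF that] by blast
  have dom_Q: "Q (Suc j) \<in> tmle_dom \<mu> M \<C> \<Psi> T j" if "j \<le> k" for j
    unfolding Q_def
  proof (rule iter_emp_in_tmle_dom[OF _ _ that])
    show "init T \<in> tmle_dom \<mu> M \<C> \<Psi> T k"
      using exist_hal by blast
    show "eps_emp T i (iter_emp T (Suc i) k (init T)) \<in> lfp_range T i (iter_emp T (Suc i) k (init T))"
      if "i \<in> {1..k}" for i
      using score_Q[OF that] by (simp add: solves_score_eq_def Q_def)
  qed
  \<comment> \<open>Instantiated below at \<open>P\<^sub>0\<close> and at every partially updated estimator.\<close>
  have update: "(\<integral>y. grad T j (upd_emp T j P) y \<partial>Pn) = 0 \<and>
      integrable Pn (grad T j (upd_emp T j P)) \<and> integrable ?H (grad T j (upd_emp T j P))"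
    if j: "j \<in> {1..k}" and dom: "P \<in> tmle_dom \<mu> M \<C> \<Psi> T j"
      and score: "solves_score_eq T Pn j P (eps_emp T j P)" for j P
  proof -
    obtain i where i: "j = Suc i"
      using j by (cases j) auto
    have range: "eps_emp T (Suc i) P \<in> lfp_range T (Suc i) P"
      using score unfolding i solves_score_eq_def by blast
    show ?thesis
      using score integrable_hal_grad[OF dom[unfolded i] range]
        integrable_empirical[OF grad_measurable[OF dom[unfolded i] range model(1)] sample_in_space]
      unfolding i upd_emp_def empirical solves_score_eq_def by (intro conjI) simp_all
  qed
  have emp: "diff_integral Pn P0 (grad T j (U j)) + remainder \<Psi> T j (U j) P0
      + diff_integral ?H Pn (\<lambda>y. grad T j (U j) y - grad T j (Q j) y)
      + (remainder \<Psi> T j (Q j) ?H - remainder \<Psi> T j (U j) ?H)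
    = target \<Psi> T (j - 1) (Q j) - target \<Psi> T (j - 1) P0" if j: "j \<in> {1..k}" for j
  proof -
    have "j \<le> k" using j by simp
    with update[OF j dom_P0 score_P0] update[OF j dom_Q score_Q] j show ?thesis
      by (intro empirical_terms_collapse) (simp_all add: U_def Q_step)
  qed
  have hal_upd: "remainder \<Psi> T j (upd_hal T j (Q (Suc j))) ?H - remainder \<Psi> T j (upd_hal T j P0) ?H
    = target \<Psi> T j (Q (Suc j)) - target \<Psi> T j P0" if j: "j \<in> {1..k}" for j
  proof -
    obtain i where i: "j = Suc i" "Suc i \<le> k"
      using j by (cases j) auto
    show ?thesis
      unfolding i(1) using dom_Q[OF i(2)] dom_P0[OF i(2)] by (intro hal_terms_collapse) simp_all
  qed
  \<comment> \<open>Both collapsed families are values of this sequence, the first one shifted by one.\<close>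
  define \<Delta> where "\<Delta> j = target \<Psi> T j (Q (Suc j)) - target \<Psi> T j P0" for j
  let ?A = "\<lambda>j. diff_integral Pn P0 (grad T j (U j)) + remainder \<Psi> T j (U j) P0"
  let ?B = "\<lambda>j. diff_integral ?H Pn (\<lambda>y. grad T j (U j) y - grad T j (Q j) y)"
  let ?R = "\<lambda>j. remainder \<Psi> T j (Q j) ?H - remainder \<Psi> T j (U j) ?H"
  let ?S = "\<lambda>j. remainder \<Psi> T j (upd_hal T j (Q (Suc j))) ?H - remainder \<Psi> T j (upd_hal T j P0) ?H"
  obtain m where m: "k = Suc m"
    using k by (cases k) auto
  have "(\<Sum>j=1..k. ?A j) + ?R k + (\<Sum>j=1..k. ?B j) + (\<Sum>j=1..k-1. ?R j)
      = (\<Sum>j=1..k. ?A j + ?B j + ?R j)"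
    by (simp add: m sum.distrib)
  also have "\<dots> = (\<Sum>j=1..k. \<Delta> (j - 1))"
    using emp by (intro sum.cong) (auto simp: \<Delta>_def)
  also have "\<dots> = \<Delta> 0 + (\<Sum>j=1..k-1. \<Delta> j)"
    using sum.atLeast_Suc_atMost[of 0 m \<Delta>] sum.shift_bounds_cl_Suc_ivl[of "\<lambda>j. \<Delta> (j - 1)" 0 m]
    by (simp add: m)
  also have "(\<Sum>j=1..k-1. \<Delta> j) = (\<Sum>j=1..k-1. ?S j)"
    using hal_upd by (intro sum.cong) (auto simp: \<Delta>_def)
  finally have main: "\<Delta> 0 = (\<Sum>j=1..k. ?A j) + ?R k + (\<Sum>j=1..k. ?B j) + (\<Sum>j=1..k-1. ?R j)
      - (\<Sum>j=1..k-1. ?S j)"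
    by linarith
  have "upd_emp T k (init T) = Q k"
    using Q_step[of k] by (simp add: Q_def iter_emp_def)
  with main show ?thesis
    by (simp add: \<Delta>_def U_def Q_def)
qed

end
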